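(* Let $\mu\in\mathbb{R}$, $\sigma>0$, $\alpha\in\mathbb{R}$, $\boldsymbol{\theta}=(\mu,\sigma,\alpha)$, and let $X\sim\text{BN}(\boldsymbol{\theta})$. Then for every positive integer $n$, $$\mathbb{E}\left[\left(\frac{X-\mu}{\sqrt{\mathrm{Var}(X)}}\right)^n\right]=\begin{cases}\dfrac{1}{(1+\alpha^2)^{n/2}}\displaystyle\sum_{\substack{0\le k\le n\\ k\ \mathrm{even}}}\binom nk\alpha^{n-k}\,2^{-k/2}\,\frac{k!}{(k/2)!}, & n\ \text{even},\\[2mm] 0, & n\ \text{odd}.\end{cases}$$
   Context: For $\boldsymbol{\theta}=(\mu,\sigma,\alpha)$, $\mu\in\mathbb{R}$, $\sigma>0$, $\alpha\in\mathbb{R}$, $X\sim\text{BN}(\boldsymbol{\theta})$ means that $X$ is a real random variable with PDF $$f(x;\boldsymbol{\theta})=\frac{1}{\sqrt{2\pi\sigma^2}}\exp\left[-\frac12\left(\frac{x-\mu}{\sigma}\right)^2-\frac{\alpha^2}{2}\right]\cosh\left[\alpha\left(\frac{x-\mu}{\sigma}\right)\right],\quad x\in\mathbb{R}.$$ Convention: $0^0=1$. *)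

theory Defs
  imports "HOL-Probability.Probability"
begin

definition bn_density :: "real \<Rightarrow> real \<Rightarrow> real \<Rightarrow> real \<Rightarrow> real" where
  "bn_density \<mu> \<sigma> \<alpha> x =
     1 / sqrt (2 * pi * \<sigma>\<^sup>2) * exp (- (1 / 2) * ((x - \<mu>) / \<sigma>)\<^sup>2 - \<alpha>\<^sup>2 / 2) * cosh (\<alpha> * ((x - \<mu>) / \<sigma>))"

end

theory Submission
  imports Defs
begin

text \<open>
  Expanding the hyperbolic cosine shows that the density is the equal mixture of the normal
  densities with means \<open>\<mu> + \<sigma> \<alpha>\<close> and \<open>\<mu> - \<sigma> \<alpha>\<close>. Thus \<open>(X - \<mu>) / \<sigma>\<close> is distributed as \<open>Z + \<epsilon> \<alpha>\<close>
  with \<open>Z\<close> standard normal and \<open>\<epsilon>\<close> an independent fair sign. The binomial theorem turns the moments of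
  \<open>Z + \<alpha>\<close> into the stated sum, and replacing \<open>\<alpha>\<close> by \<open>-\<alpha>\<close> multiplies that sum by \<open>(-1) ^ n\<close>.
  The cases \<open>n = 1, 2\<close> give mean \<open>\<mu>\<close> and variance \<open>\<sigma>\<^sup>2 (1 + \<alpha>\<^sup>2)\<close>.
\<close>

text \<open>This is the \<open>n\<close>-th moment of Z + \<open>a\<close> for standard normal Z.
  Odd \<open>k\<close> are absent because the odd moments of Z vanish.\<close>

definition shifted_normal_moment :: "real \<Rightarrow> nat \<Rightarrow> real" where
  "shifted_normal_moment a n =
     (\<Sum>k | k \<le> n \<and> even k.
        real (n choose k) * a ^ (n - k) * 2 powr (- (real k / 2)) * (fact k / fact (k div 2)))"

text \<open>Puts both parities into one formula that can be summed over \<open>k\<close>. Using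
  \<open>has_bochner_integral\<close> carries integrability along with the value.\<close>

lemma std_normal_moment:
  "has_bochner_integral lborel (\<lambda>x. std_normal_density x * x ^ k)
     (if even k then 2 powr (- (real k / 2)) * (fact k / fact (k div 2)) else 0)"
proof (cases "even k")
  case True
  then obtain j where k: "k = 2 * j" ..
  have "2 powr (- (real k / 2)) = (1 / 2 ^ j :: real)"
    by (simp add: k powr_minus_divide powr_realpow)
  then show ?thesis
    using std_normal_moment_even[of j] True by (simp add: k)
next
  case False
  then obtain j where "k = 2 * j + 1" ..
  then show ?thesis
    using std_normal_moment_odd[of j] by simp
qed

lemma std_normal_shifted_moment:
  "has_bochner_integral lborel (\<lambda>x. std_normal_density x * (x + a) ^ n) (shifted_normal_moment a n)"
proof -
  let ?m = "\<lambda>k. if even k then 2 powr (- (real k / 2)) * (fact k / fact (k div 2)) else 0 :: real"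
  have "has_bochner_integral lborel
      (\<lambda>x. \<Sum>k\<le>n. (real (n choose k) * a ^ (n - k)) * (std_normal_density x * x ^ k))
      (\<Sum>k\<le>n. (real (n choose k) * a ^ (n - k)) * ?m k)"
    by (intro has_bochner_integral_sum has_bochner_integral_mult_right std_normal_moment)
  moreover have "(\<Sum>k\<le>n. (real (n choose k) * a ^ (n - k)) * (std_normal_density x * x ^ k))
      = std_normal_density x * (x + a) ^ n" for x
    by (simp add: binomial_ring sum_distrib_left mult_ac)
  moreover have "(\<Sum>k\<le>n. (real (n choose k) * a ^ (n - k)) * ?m k) = shifted_normal_moment a n"
    unfolding shifted_normal_moment_def
    by (intro sum.mono_neutral_cong_right) (auto simp: mult_ac)
  ultimately show ?thesis by simp
qed

lemma normal_shifted_moment: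
  assumes "\<sigma> > 0"
  shows "has_bochner_integral lborel
    (\<lambda>x. normal_density (\<mu> + \<sigma> * a) \<sigma> x * ((x - \<mu>) / \<sigma>) ^ n) (shifted_normal_moment a n)"
proof -
  have "normal_density (\<mu> + \<sigma> * a) \<sigma> (\<mu> + \<sigma> * a + \<sigma> * x) * ((\<mu> + \<sigma> * a + \<sigma> * x - \<mu>) / \<sigma>) ^ n
      = std_normal_density x * (x + a) ^ n / \<sigma>" for x
  proof -
    have "(\<mu> + \<sigma> * a + \<sigma> * x - \<mu>) / \<sigma> = x + a"
      using assms by (simp add: field_simps)
    moreover have "normal_density (\<mu> + \<sigma> * a) \<sigma> (\<mu> + \<sigma> * a + \<sigma> * x) = std_normal_density x / \<sigma>"
      using assms by (simp add: normal_density_def real_sqrt_mult power_mult_distrib)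
    ultimately show ?thesis by simp
  qed
  then show ?thesis
    using has_bochner_integral_divide_zero[OF std_normal_shifted_moment[of a n], of \<sigma>] assms
    \<comment> \<open>After centring and rescaling, the Jacobian accounts for the factor 1 /
      \<open>\<sigma>\<close> left over from the density.\<close>
    by (subst lborel_has_bochner_integral_real_affine_iff[where c = \<sigma> and t = "\<mu> + \<sigma> * a"])
       (simp_all add: divide_inverse mult_ac)
qed

lemma bn_density_eq_mixture:
  assumes "\<sigma> > 0"
  shows "bn_density \<mu> \<sigma> \<alpha> x =
    (normal_density (\<mu> + \<sigma> * \<alpha>) \<sigma> x + normal_density (\<mu> + \<sigma> * (- \<alpha>)) \<sigma> x) / 2"
proof -
  define z where "z = (x - \<mu>) / \<sigma>"
  have x: "x = \<mu> + \<sigma> * z" using assms by (simp add: z_def)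
  \<comment> \<open>Expanding (z - b)^2 isolates exp (b z). The remaining factor depends on b only
    through b^2, so b = \<alpha> and b = -\<alpha> share it and the two exponentials add up to a
    cosh.\<close>
  have e: "normal_density (\<mu> + \<sigma> * b) \<sigma> x = 1 / sqrt (2 * pi * \<sigma>\<^sup>2) * exp (- (1 / 2) * z\<^sup>2 - b\<^sup>2 / 2) * exp (b * z)" for b
  proof -
    have "- (x - (\<mu> + \<sigma> * b))\<^sup>2 / (2 * \<sigma>\<^sup>2) = (- (1 / 2) * z\<^sup>2 - b\<^sup>2 / 2) + b * z"
      using assms by (simp add: x field_simps power2_eq_square)
    then show ?thesis
      by (simp only: normal_density_def exp_add mult.assoc)
  qed
  show ?thesis
    unfolding bn_density_def z_def[symmetric] e
    by (simp add: cosh_def distrib_left add_divide_distrib)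
qed

lemma shifted_normal_moment_minus:
  "shifted_normal_moment (- a) n = (- 1) ^ n * shifted_normal_moment a n"
proof -
  \<comment> \<open>For even \<open>k\<close>, n - k has the parity of n, so the sign is the same in
    every summand.\<close>
  have "(- a) ^ (n - k) = (- 1) ^ n * a ^ (n - k)" if "k \<le> n" "even k" for k
    using that by (subst power_minus) (simp add: minus_one_power_iff)
  then show ?thesis
    unfolding shifted_normal_moment_def sum_distrib_left
    by (intro sum.cong) (auto simp: mult_ac)
qed

text \<open>The two mixture components have equal moments for even \<open>n\<close> and opposite
  ones for odd \<open>n\<close>.\<close>

lemma bn_density_moment:
  assumes "\<sigma> > 0"
  shows "has_bochner_integral lborel (\<lambda>x. bn_density \<mu> \<sigma> \<alpha> x * ((x - \<mu>) / \<sigma>) ^ n)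
    (if even n then shifted_normal_moment \<alpha> n else 0)"
proof -
  have "has_bochner_integral lborel
      (\<lambda>x. (normal_density (\<mu> + \<sigma> * \<alpha>) \<sigma> x * ((x - \<mu>) / \<sigma>) ^ n
          + normal_density (\<mu> + \<sigma> * (- \<alpha>)) \<sigma> x * ((x - \<mu>) / \<sigma>) ^ n) / 2)
      ((shifted_normal_moment \<alpha> n + shifted_normal_moment (- \<alpha>) n) / 2)"
    by (intro has_bochner_integral_divide_zero has_bochner_integral_add normal_shifted_moment assms)
  then show ?thesis
    by (simp add: bn_density_eq_mixture[OF assms] shifted_normal_moment_minus distrib_right
        minus_one_power_iff cong: if_cong split: if_splits)
qed

lemma bn_distributed_moment:
  assumes D: "distributed M lborel X (\<lambda>x. ennreal (bn_density \<mu> \<sigma> \<alpha> x))" and "\<sigma> > 0"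
  shows "has_bochner_integral M (\<lambda>\<omega>. ((X \<omega> - \<mu>) / \<sigma>) ^ n)
    (if even n then shifted_normal_moment \<alpha> n else 0)"
proof -
  have nonneg: "0 \<le> bn_density \<mu> \<sigma> \<alpha> x" for x
    by (simp add: bn_density_eq_mixture[OF \<open>\<sigma> > 0\<close>])
  have meas: "(\<lambda>x. ((x - \<mu>) / \<sigma>) ^ n) \<in> borel_measurable lborel" by simp
  show ?thesis
    using bn_density_moment[OF \<open>\<sigma> > 0\<close>, of \<mu> \<alpha> n]
    unfolding has_bochner_integral_iff distributed_integrable[OF D meas nonneg]
      distributed_integral[OF D meas nonneg] .
qed

lemma shifted_normal_moment_2: "shifted_normal_moment a 2 = 1 + a\<^sup>2"
proof -
  have "{k. k \<le> 2 \<and> even k} = {0, 2 :: nat}"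
    by (auto simp: numeral_2_eq_2 le_Suc_eq)
  then show ?thesis
    by (simp add: shifted_normal_moment_def powr_minus)
qed

theorem proposition4p3:
  fixes M :: "'a measure" and X :: "'a \<Rightarrow> real" and \<mu> \<sigma> \<alpha> :: real and n :: nat
  assumes "prob_space M"
    and "\<sigma> > 0"
    and "distributed M lborel X (\<lambda>x. ennreal (bn_density \<mu> \<sigma> \<alpha> x))"
    and "n > 0"
  shows "integrable M (\<lambda>\<omega>. ((X \<omega> - \<mu>) / sqrt (prob_space.variance M X)) ^ n) \<and>
    prob_space.expectation M (\<lambda>\<omega>. ((X \<omega> - \<mu>) / sqrt (prob_space.variance M X)) ^ n) =
      (if even n then
         1 / (1 + \<alpha>\<^sup>2) powr (real n / 2) *
         (\<Sum>k | k \<le> n \<and> even k.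
            real (n choose k) * \<alpha> ^ (n - k) * 2 powr (- (real k / 2)) * (fact k / fact (k div 2)))
       else 0)"
proof -
  interpret prob_space M by fact
  note moment = bn_distributed_moment[OF assms(3) \<open>\<sigma> > 0\<close>]
  define s where "s = sqrt (1 + \<alpha>\<^sup>2)"
  have "s > 0" by (simp add: s_def add_pos_nonneg)
  \<comment> \<open>The first moment, rescaled by \<open>\<sigma>\<close>, centres X at \<mu>; the
    second one below gives the variance.\<close>
  have "has_bochner_integral M (\<lambda>\<omega>. X \<omega> - \<mu>) 0"
    using has_bochner_integral_mult_right[OF moment[of 1], of \<sigma>] \<open>\<sigma> > 0\<close> by simp
  then have "expectation (\<lambda>\<omega>. (X \<omega> - \<mu>) + \<mu>) = \<mu>"
    by (subst Bochner_Integration.integral_add) (simp_all add: has_bochner_integral_iff prob_space)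
  then have mean: "expectation X = \<mu>"
    by simp
  have "variance X = expectation (\<lambda>\<omega>. \<sigma>\<^sup>2 * ((X \<omega> - \<mu>) / \<sigma>)\<^sup>2)"
    using \<open>\<sigma> > 0\<close> by (simp add: mean power_divide)
  also have "\<dots> = \<sigma>\<^sup>2 * (1 + \<alpha>\<^sup>2)"
    using has_bochner_integral_mult_right[OF moment[of 2], of "\<sigma>\<^sup>2"]
    by (simp add: has_bochner_integral_iff shifted_normal_moment_2)
  finally have sd: "sqrt (variance X) = \<sigma> * s"
    using \<open>\<sigma> > 0\<close> by (simp add: s_def real_sqrt_mult)
  \<comment> \<open>Since \<open>X\<close> has standard deviation \<open>\<sigma> * s\<close>, the
    moment of (X - \<mu>) / \<sigma> only has to be divided by \<open>s ^ n\<close>, which is the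
    prefactor of the claim.\<close>
  have "s ^ n = (1 + \<alpha>\<^sup>2) powr (real n / 2)"
    using powr_realpow[OF \<open>s > 0\<close>, of n] by (simp add: s_def powr_powr flip: powr_half_sqrt)
  then show ?thesis
    using has_bochner_integral_divide_zero[OF moment[of n], of "s ^ n"]
    unfolding sd has_bochner_integral_iff
    by (simp add: power_divide power_mult_distrib shifted_normal_moment_def)
qed

end
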